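(* Let $H$ be a real Hilbert space, let $A_0\colon \operatorname{dom}(A_0)\subseteq H\to H$ be a densely defined, closed, skew-symmetric linear operator, and set $A:=-A_0^{*}$. Let $(F,G_1,G_2)$ be a boundary system for $A$, and let $B\subseteq A$ be a (possibly nonlinear) restriction of $A$. Then $B$ is m-accretive if and only if there exists a mapping $g\colon G_1\to G_2$ with $$\forall a,b\in G_1:\ \|g(a)-g(b)\|_{G_2}\le \|a-b\|_{G_1}$$ such that $$\operatorname{dom}(B)=\{u\in\operatorname{dom}(A)\,;\, g(F_1u)=F_2u\}.$$
   Context: All Hilbert spaces are real. A linear operator $A_0$ is skew-symmetric if $A_0\subseteq -A_0^{*}$, i.e. $\langle A_0u,v\rangle=-\langle u,A_0v\rangle$ for all $u,v\in\operatorname{dom}(A_0)$. Restriction: $B\subseteq A$ means that $B$ is a map defined on an arbitrary subset $\operatorname{dom}(B)\subseteq\operatorname{dom}(A)$ (not necessarily a linear subspace) with $B(u)=Au$ for all $u\in\operatorname{dom}(B)$. A (possibly nonlinear) mapping $B\colon\operatorname{dom}(B)\subseteq H\to H$ is accretive if $\langle B(u)-B(v),u-v\rangle\ge 0$ for all $u,v\in\operatorname{dom}(B)$; it is m-accretive if it is accretive and $1+B\colon\operatorname{dom}(B)\to H$, $u\mapsto u+B(u)$, is onto. A triple $(F,G_1,G_2)$ is a boundary system for $A$ if $G_1,G_2$ are Hilbert spaces, $F\colon\operatorname{dom}(A)\to G_1\times G_2$ is linear and onto, and for all $u,v\in\operatorname{dom}(A)$ $$\langle Au,v\rangle+\langle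 u,Av\rangle=\langle F_1u,F_1v\rangle_{G_1}-\langle F_2u,F_2v\rangle_{G_2},$$ where $F_1,F_2$ denote the components of $F$ with values in $G_1$ and $G_2$, respectively. *)

theory Defs
  imports "HOL-Analysis.Analysis"
begin

text \<open>
  A possibly nonlinear mapping from \<open>dom T \<subseteq> H\<close> to \<open>H\<close> is a partial function \<open>T :: 'h \<rightharpoonup> 'h\<close>;
  its value at \<open>u \<in> dom T\<close> is \<open>the (T u)\<close>, its graph is \<open>Map.graph T\<close>, and the restriction
  relation \<open>B \<subseteq> A\<close> is \<open>B \<subseteq>\<^sub>m A\<close>.  A real Hilbert space is a type of sort
  \<open>{real_inner, complete_space}\<close>.
\<close>

definition linear_operator :: "('h::real_vector \<rightharpoonup> 'h) \<Rightarrow> bool" where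
  "linear_operator T \<longleftrightarrow>
     subspace (dom T) \<and>
     (\<forall>u\<in>dom T. \<forall>v\<in>dom T. the (T (u + v)) = the (T u) + the (T v)) \<and>
     (\<forall>c. \<forall>u\<in>dom T. the (T (c *\<^sub>R u)) = c *\<^sub>R the (T u))"

definition densely_defined :: "('h::real_inner \<rightharpoonup> 'h) \<Rightarrow> bool" where
  "densely_defined T \<longleftrightarrow> closure (dom T) = UNIV"

definition closed_operator :: "('h::real_inner \<rightharpoonup> 'h) \<Rightarrow> bool" where
  "closed_operator T \<longleftrightarrow> closed (Map.graph T)"

text \<open>
  Meaningful for densely defined \<open>T\<close> only: then the vector \<open>w\<close> is unique, see
  \<open>op_adjoint_eq_Some_iff\<close> below.
\<close>

definition op_adjoint :: "('h::real_inner \<rightharpoonup> 'h) \<Rightarrow> ('h \<rightharpoonup> 'h)" where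
  "op_adjoint T v =
     (if \<exists>w. \<forall>u\<in>dom T. inner (the (T u)) v = inner u w
      then Some (THE w. \<forall>u\<in>dom T. inner (the (T u)) v = inner u w)
      else None)"

definition op_uminus :: "('h::real_vector \<rightharpoonup> 'h) \<Rightarrow> ('h \<rightharpoonup> 'h)" where
  "op_uminus T u = map_option uminus (T u)"

definition skew_symmetric :: "('h::real_inner \<rightharpoonup> 'h) \<Rightarrow> bool" where
  "skew_symmetric T \<longleftrightarrow> T \<subseteq>\<^sub>m op_uminus (op_adjoint T)"

definition accretive :: "('h::real_inner \<rightharpoonup> 'h) \<Rightarrow> bool" where
  "accretive B \<longleftrightarrow>
     (\<forall>u\<in>dom B. \<forall>v\<in>dom B. inner (the (B u) - the (B v)) (u - v) \<ge> 0)"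

definition m_accretive :: "('h::real_inner \<rightharpoonup> 'h) \<Rightarrow> bool" where
  "m_accretive B \<longleftrightarrow> accretive B \<and> (\<lambda>u. u + the (B u)) ` dom B = UNIV"

text \<open>
  The Hilbert spaces \<open>G\<^sub>1\<close> and \<open>G\<^sub>2\<close> of a boundary system \<open>(F, G\<^sub>1, G\<^sub>2)\<close> are the types \<open>'g1\<close> and
  \<open>'g2\<close>.  The values of \<open>F\<close> outside \<open>dom A\<close> play no role.
\<close>

definition boundary_system ::
  "('h::real_inner \<rightharpoonup> 'h) \<Rightarrow>
   ('h \<Rightarrow> 'g1::{real_inner,complete_space} \<times> 'g2::{real_inner,complete_space}) \<Rightarrow> bool" where
  "boundary_system A F \<longleftrightarrow>
     (\<forall>u\<in>dom A. \<forall>v\<in>dom A. F (u + v) = F u + F v) \<and>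
     (\<forall>c. \<forall>u\<in>dom A. F (c *\<^sub>R u) = c *\<^sub>R F u) \<and>
     F ` dom A = UNIV \<and>
     (\<forall>u\<in>dom A. \<forall>v\<in>dom A.
        inner (the (A u)) v + inner u (the (A v)) =
        inner (fst (F u)) (fst (F v)) - inner (snd (F u)) (snd (F v)))"

lemma op_adjoint_eq_Some_iff:
  assumes "densely_defined T"
  shows "op_adjoint T v = Some w \<longleftrightarrow> (\<forall>u\<in>dom T. inner (the (T u)) v = inner u w)"
proof -
  have uniq: "w1 = w2"
    if "\<forall>u\<in>dom T. inner (the (T u)) v = inner u w1"
      and "\<forall>u\<in>dom T. inner (the (T u)) v = inner u w2" for w1 w2
  proof -
    have "dom T \<subseteq> {u. inner u (w1 - w2) = 0}"
    proof
      fix u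
      assume "u \<in> dom T"
      with that have "inner u w1 = inner u w2" by metis
      then show "u \<in> {u. inner u (w1 - w2) = 0}" by (simp add: inner_diff_right)
    qed
    moreover have "closed {u. inner u (w1 - w2) = 0}"
      by (intro closed_Collect_eq continuous_intros)
    ultimately have "closure (dom T) \<subseteq> {u. inner u (w1 - w2) = 0}"
      by (rule closure_minimal)
    then have "inner (w1 - w2) (w1 - w2) = 0"
      using assms unfolding densely_defined_def
      by (metis (mono_tags) UNIV_I mem_Collect_eq subsetD)
    then show ?thesis by simp
  qed
  have the_eq: "(THE w. \<forall>u\<in>dom T. inner (the (T u)) v = inner u w) = w"
    if "\<forall>u\<in>dom T. inner (the (T u)) v = inner u w" for w
    by (rule the_equality, rule that) (rule uniq[OF _ that])
  show ?thesis
  proof (cases "\<exists>w. \<forall>u\<in>dom T. inner (the (T u)) v = inner u w")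
    case True
    then obtain w' where w': "\<forall>u\<in>dom T. inner (the (T u)) v = inner u w'" ..
    have "op_adjoint T v = Some w'"
      unfolding op_adjoint_def the_eq[OF w'] if_P[OF True] ..
    with w' uniq show ?thesis by auto
  next
    case False
    have "op_adjoint T v = None"
      unfolding op_adjoint_def if_not_P[OF False] ..
    with False show ?thesis by auto
  qed
qed

lemma skew_symmetric_iff:
  assumes "densely_defined T"
  shows "skew_symmetric T \<longleftrightarrow>
    (\<forall>u\<in>dom T. \<forall>v\<in>dom T. inner (the (T u)) v = - inner u (the (T v)))"
proof -
  have eq: "op_uminus (op_adjoint T) v = Some w \<longleftrightarrow> op_adjoint T v = Some (- w)" for v w
    unfolding op_uminus_def by (cases "op_adjoint T v") (auto simp: minus_equation_iff)
  have "T v = op_uminus (op_adjoint T) v \<longleftrightarrow>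
      (\<forall>u\<in>dom T. inner (the (T u)) v = - inner u (the (T v)))" if "v \<in> dom T" for v
  proof -
    from that have Tv: "T v = Some (the (T v))" by auto
    have "T v = op_uminus (op_adjoint T) v \<longleftrightarrow> op_uminus (op_adjoint T) v = Some (the (T v))"
      by (subst Tv) (rule eq_commute)
    then show ?thesis
      by (simp add: eq op_adjoint_eq_Some_iff[OF assms])
  qed
  then have "skew_symmetric T \<longleftrightarrow>
      (\<forall>v\<in>dom T. \<forall>u\<in>dom T. inner (the (T u)) v = - inner u (the (T v)))"
    unfolding skew_symmetric_def map_le_def by (intro ball_cong refl)
  then show ?thesis by blast
qed

end

theory Submission
  imports Defs
begin

text \<open>
  Write $[(a,b),(a',b')] = \langle a,a'\rangle - \langle b,b'\rangle$ for the indefinite form on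
  $G_1 \times G_2$, so that the boundary system turns $2\langle Au,u\rangle$ into $[Fu,Fu]$.
  Accretivity of $B$ thus says precisely that the boundary relation $F(\mathrm{dom}\,B)$ is the
  graph of a nonexpansive map from a subset of $G_1$ to $G_2$.  The point is how surjectivity of
  $1+B$ is related to this subset being all of $G_1$.

  The domain of $A$ is the sum of $\mathrm{dom}\,A_0$, $P = \ker(1-A)$ and $N = \ker(1+A)$, and
  $F$ vanishes on $\mathrm{dom}\,A_0$.  Green's identity gives $[Fp,Fp] = 2\|p\|^2$ on $P$ and
  $[Fn,Fn] = -2\|n\|^2$ on $N$.  Up to $F$, the pair $(P,N)$ is therefore another splitting of the
  same indefinite space into a positive and a negative part, next to $(G_1,G_2)$.  The range of
  $1+A$ is the sum of the range of $1+A_0$ and $P$, and the solutions of $u + Au = f$ form a coset of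
  $N$.  Surjectivity of $1+B$ therefore makes $F(\mathrm{dom}\,B)$ a graph over all of $P$; conversely,
  a domain given by a boundary condition meets every coset of $N$ once its boundary relation is such
  a graph.  So what matters is that a nonexpansive graph over the whole positive part of one
  splitting is a graph over the whole positive part of the other one.  In either direction this is a
  fixed point equation for a coordinate in the new splitting, and the linear change of
  coordinates contributes a factor less than one, so that Banach's theorem
  applies (\<open>kernel_plus_meets_nonexpansive\<close> and \<open>F1_onto_graph\<close>).

  The uniform bound below one comes from an estimate
  $\|F_2 n\| \le M\|n\|$ on $N$ (\<open>F2_bounded_on_kernel_plus\<close>), which follows from the principle of
  uniform boundedness: as $F$ is onto, Green's identity bounds $\langle F_2 n, y\rangle$ by a multiple
  of $\|n\|$ for each single $y$.  The same estimate shows that $F_2$ maps $N$ onto $G_2$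
  (\<open>F2_kernel_plus_onto\<close>).  Everything proved about $N$ holds for $P$ after replacing $A$ by $-A$ and
  exchanging $F_1$ with $F_2$ (\<open>skew_extension_uminus\<close>).

  Finally, the graph condition describes $\mathrm{dom}\,B$ completely, because an accretive operator
  with $1+B$ onto has no proper accretive extension.
\<close>

section \<open>Boundedness and projection in Hilbert spaces\<close>

text \<open>
  The principle of uniform boundedness for a set of vectors regarded as functionals.  By Baire's
  theorem the functionals are uniformly bounded on some ball, and moving from the centre of that
  ball in the direction of $x$ turns a bound on inner products into a bound on the norm of $x$.
\<close>
lemma weakly_bounded_imp_bounded:
  fixes S :: "'a::{real_inner,complete_space} set"
  assumes "\<And>y. \<exists>C. \<forall>x\<in>S. \<bar>inner x y\<bar> \<le> C"
  shows "bounded S"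
proof -
  define X where "X k = {y. \<forall>x\<in>S. \<bar>inner x y\<bar> \<le> real k}" for k :: nat
  have closed_X: "closed (X k)" for k
  proof -
    have "X k = (\<Inter>x\<in>S. {y. \<bar>inner x y\<bar> \<le> real k})"
      by (auto simp: X_def)
    then show ?thesis
      by (auto intro!: closed_INT closed_Collect_le continuous_intros)
  qed
  have "y \<in> \<Union>(range X)" for y
  proof -
    obtain C where "\<forall>x\<in>S. \<bar>inner x y\<bar> \<le> C" using assms by blast
    moreover obtain k :: nat where "C \<le> real k" using real_arch_simple by blast
    ultimately have "y \<in> X k" unfolding X_def by fastforce
    then show ?thesis by blast
  qed
  then have cover: "\<Union>(range X) = UNIV" by blast
  have "\<exists>k. interior (X k) \<noteq> {}"
  proof (rule ccontr)
    assume "\<not> ?thesis"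
    then have "(euclidean :: 'a topology) interior_of \<Union>(range X) = {}"
      using Met_TC.metric_Baire_category_alt[of "range X"] closed_X
      by (auto simp: Met_TC.mcomplete_def Cauchy_convergent_iff convergent_def)
    with cover show False by simp
  qed
  then obtain k y r where r: "r > 0" "ball y r \<subseteq> X k"
    by (metis ex_in_conv mem_interior)
  have "norm x \<le> 4 * real k / r" if "x \<in> S" for x
  proof (cases "x = 0")
    case False
    let ?z = "y + (r / (2 * norm x)) *\<^sub>R x"
    have "?z \<in> X k" "y \<in> X k"
      using r False by (auto simp: dist_norm intro!: subsetD[OF r(2)])
    then have "\<bar>inner x ?z\<bar> \<le> real k" "\<bar>inner x y\<bar> \<le> real k"
      using that by (auto simp: X_def)
    moreover have "inner x ?z = inner x y + r * norm x / 2"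
      using False by (simp add: inner_add_right dot_square_norm power2_eq_square)
    ultimately have "r * norm x / 2 \<le> 2 * real k" by linarith
    with r show ?thesis by (simp add: field_simps)
  qed (use r in auto)
  then show ?thesis by (auto simp: bounded_iff)
qed

text \<open>
  The nearest point of \<open>S\<close>: by the parallelogram law, every sequence in \<open>S\<close> that minimises the
  distance to \<open>x\<close> is Cauchy.
\<close>
lemma orthogonal_projection_exists:
  fixes S :: "'a::real_inner set"
  assumes S: "subspace S" "complete S"
  obtains s where "s \<in> S" "\<And>t. t \<in> S \<Longrightarrow> inner (x - s) t = 0"
proof -
  define q where "q s = (norm (x - s))\<^sup>2" for s
  define d where "d = Inf (q ` S)"
  define \<epsilon> where "\<epsilon> k = inverse (real (Suc k))" for k
  have ne: "q ` S \<noteq> {}" using S subspace_0 by blast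
  have bdd: "bdd_below (q ` S)" by (rule bdd_belowI[of _ 0]) (auto simp: q_def)
  have d_le: "d \<le> q s" if "s \<in> S" for s
    unfolding d_def using bdd that by (simp add: cInf_lower)
  have "\<exists>s\<in>S. q s < d + \<epsilon> k" for k
    using cInf_lessD[OF ne, of "d + \<epsilon> k"] by (auto simp: d_def \<epsilon>_def)
  then obtain f where f: "\<And>k. f k \<in> S" "\<And>k. q (f k) < d + \<epsilon> k"
    by metis
  have parallelogram: "(norm (s - t))\<^sup>2 \<le> 2 * (q s - d) + 2 * (q t - d)"
    if "s \<in> S" "t \<in> S" for s t
  proof -
    have "(1/2) *\<^sub>R (s + t) \<in> S" using S that by (simp add: subspace_add subspace_scale)
    then have "d \<le> q ((1/2) *\<^sub>R (s + t))" by (rule d_le)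
    moreover have "(norm (s - t))\<^sup>2 = 2 * q s + 2 * q t - 4 * q ((1/2) *\<^sub>R (s + t))"
      unfolding q_def power2_norm_eq_inner
      by (simp add: inner_diff_left inner_diff_right inner_add_left inner_add_right
          inner_commute algebra_simps)
    ultimately show ?thesis by simp
  qed
  have "Cauchy f"
  proof (rule CauchyI)
    fix e :: real
    assume e: "0 < e"
    then obtain K where K: "\<epsilon> K < e\<^sup>2 / 4"
      using reals_Archimedean[of "e\<^sup>2 / 4"] by (auto simp: \<epsilon>_def)
    have "norm (f m - f n) < e" if "m \<ge> K" "n \<ge> K" for m n
    proof -
      have "\<epsilon> m \<le> \<epsilon> K" "\<epsilon> n \<le> \<epsilon> K"
        using that by (auto simp: \<epsilon>_def intro!: le_imp_inverse_le)
      then have "2 * (q (f m) - d) + 2 * (q (f n) - d) < 4 * \<epsilon> K"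
        using f(2)[of m] f(2)[of n] by argo
      also have "\<dots> < e\<^sup>2" using K by simp
      finally have "(norm (f m - f n))\<^sup>2 < e\<^sup>2"
        using parallelogram[OF f(1)[of m] f(1)[of n]] by (rule le_less_trans[rotated])
      then show ?thesis using e by (simp add: power2_less_imp_less)
    qed
    then show "\<exists>M. \<forall>m\<ge>M. \<forall>n\<ge>M. norm (f m - f n) < e" by blast
  qed
  then obtain s where s: "s \<in> S" "f \<longlonglongrightarrow> s"
    using S(2) f(1) completeE by blast
  have "(\<lambda>k. q (f k)) \<longlonglongrightarrow> q s" unfolding q_def by (intro tendsto_intros s)
  moreover have "(\<lambda>k. d + \<epsilon> k) \<longlonglongrightarrow> d"
    unfolding \<epsilon>_def using tendsto_add[OF tendsto_const LIMSEQ_inverse_real_of_nat, of d] by simp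
  ultimately have "q s \<le> d"
    by (rule LIMSEQ_le) (use f(2) less_imp_le in blast)
  with d_le have min: "q s \<le> q t" if "t \<in> S" for t using that by fastforce
  have "inner (x - s) t = 0" if t: "t \<in> S" for t
  proof (cases "t = 0")
    case False
    \<comment> \<open>This multiple of \<open>t\<close> brings \<open>s\<close> closest to \<open>x\<close>.\<close>
    define c where "c = inner (x - s) t / (norm t)\<^sup>2"
    have "s + c *\<^sub>R t \<in> S" using S s t by (simp add: subspace_add subspace_scale)
    then have "q s \<le> q (s + c *\<^sub>R t)" by (rule min)
    also have "q (s + c *\<^sub>R t) = q s - 2 * c * inner (x - s) t + c\<^sup>2 * (norm t)\<^sup>2"
      unfolding q_def power2_norm_eq_inner
      by (simp add: inner_diff_left inner_diff_right inner_add_left inner_add_right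
          inner_commute algebra_simps power2_eq_square)
    also have "\<dots> = q s - (inner (x - s) t)\<^sup>2 / (norm t)\<^sup>2"
      using False by (simp add: c_def field_simps power2_eq_square)
    finally have "(inner (x - s) t)\<^sup>2 / (norm t)\<^sup>2 \<le> 0" by simp
    then show ?thesis using False by (simp add: divide_le_0_iff)
  qed simp
  with s(1) show ?thesis using that by blast
qed

section \<open>Maximal extensions of skew-symmetric operators and their boundary values\<close>

text \<open>
  The operators as total functions with explicit domains: \<open>T\<close> on \<open>D\<close> stands for $A = -A_0^*$,
  and its restriction to \<open>D0\<close> is $A_0$.  The assumption \<open>adjoint\<close> is the definition of $-A_0^*$ and
  already forces \<open>T\<close> to be linear and closed; \<open>D0_limit\<close> is closedness of $A_0$.  In this
  form the assumptions are invariant under \<open>T \<mapsto> -T\<close> together with exchanging \<open>F1\<close> and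
  \<open>F2\<close>.
\<close>
locale skew_extension =
  fixes D0 D :: "'h::{real_inner,complete_space} set"
    and T :: "'h \<Rightarrow> 'h"
    and F1 :: "'h \<Rightarrow> 'g1::{real_inner,complete_space}"
    and F2 :: "'h \<Rightarrow> 'g2::{real_inner,complete_space}"
  assumes subspace_D0: "subspace D0"
    and D0_subset: "D0 \<subseteq> D"
    and adjoint: "u \<in> D \<and> T u = w \<longleftrightarrow> (\<forall>z\<in>D0. inner (T z) u = - inner z w)"
    and D0_limit: "(\<And>k. z k \<in> D0) \<Longrightarrow> z \<longlonglongrightarrow> l \<Longrightarrow> (\<lambda>k. T (z k)) \<longlonglongrightarrow> m \<Longrightarrow> l \<in> D0"
    and F_add: "u \<in> D \<Longrightarrow> v \<in> D \<Longrightarrow> F1 (u + v) = F1 u + F1 v"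
      "u \<in> D \<Longrightarrow> v \<in> D \<Longrightarrow> F2 (u + v) = F2 u + F2 v"
    and F_scale: "u \<in> D \<Longrightarrow> F1 (c *\<^sub>R u) = c *\<^sub>R F1 u" "u \<in> D \<Longrightarrow> F2 (c *\<^sub>R u) = c *\<^sub>R F2 u"
    and F_onto: "\<exists>u\<in>D. F1 u = a \<and> F2 u = b"
    and green: "u \<in> D \<Longrightarrow> v \<in> D \<Longrightarrow>
      inner (T u) v + inner u (T v) = inner (F1 u) (F1 v) - inner (F2 u) (F2 v)"
begin

lemma T_add: "u \<in> D \<Longrightarrow> v \<in> D \<Longrightarrow> u + v \<in> D \<and> T (u + v) = T u + T v"
  unfolding adjoint using adjoint[of u "T u"] adjoint[of v "T v"]
  by (simp add: inner_add_right)

lemma T_scale: "u \<in> D \<Longrightarrow> c *\<^sub>R u \<in> D \<and> T (c *\<^sub>R u) = c *\<^sub>R T u"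
  unfolding adjoint using adjoint[of u "T u"] by simp

lemma T_diff: "u \<in> D \<Longrightarrow> v \<in> D \<Longrightarrow> u - v \<in> D \<and> T (u - v) = T u - T v"
  using T_add[of u "(-1) *\<^sub>R v"] T_scale[of v "-1"] by simp

lemma F_diff:
  assumes "u \<in> D" "v \<in> D"
  shows "F1 (u - v) = F1 u - F1 v" "F2 (u - v) = F2 u - F2 v"
  using F_add[of u "(-1) *\<^sub>R v"] F_scale[of v "-1"] T_scale[of v "-1"] assms by auto

lemma T_limit:
  assumes "\<And>k. u k \<in> D" "u \<longlonglongrightarrow> l" "(\<lambda>k. T (u k)) \<longlonglongrightarrow> m"
  shows "l \<in> D \<and> T l = m"
  unfolding adjoint
proof
  fix z assume z: "z \<in> D0"
  have "(\<lambda>k. inner (T z) (u k)) \<longlonglongrightarrow> inner (T z) l" by (intro tendsto_intros assms)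
  moreover have "inner (T z) (u k) = - inner z (T (u k))" for k
    using adjoint[of "u k" "T (u k)"] assms(1) z by blast
  moreover have "(\<lambda>k. - inner z (T (u k))) \<longlonglongrightarrow> - inner z m" by (intro tendsto_intros assms)
  ultimately show "inner (T z) l = - inner z m" using LIMSEQ_unique by simp
qed

text \<open>
  Green's identity makes the boundary value of \<open>z\<close> orthogonal, in the indefinite form, to all of
  $G_1 \times G_2$.  Testing with \<open>(F1 z, - F2 z)\<close> turns the form into the sum of the squared norms.
\<close>
lemma F_zero_on_D0:
  assumes "z \<in> D0"
  shows "F1 z = 0" "F2 z = 0"
proof -
  have z: "z \<in> D" using assms D0_subset by blast
  obtain v where v: "v \<in> D" "F1 v = F1 z" "F2 v = - F2 z" using F_onto by blast
  have "inner (T z) v + inner z (T v) = 0"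
    using adjoint[of v "T v"] v assms by auto
  then have "inner (F1 z) (F1 z) + inner (F2 z) (F2 z) = 0"
    using green[OF z v(1)] v by simp
  then show "F1 z = 0" "F2 z = 0"
    by (simp_all add: add_nonneg_eq_0_iff)
qed

lemma inner_T_self: "u \<in> D \<Longrightarrow> 2 * inner (T u) u = (norm (F1 u))\<^sup>2 - (norm (F2 u))\<^sup>2"
  using green[of u u] by (simp add: power2_norm_eq_inner inner_commute)

section \<open>The kernels of \<open>1 + T\<close> and \<open>1 - T\<close>\<close>

definition kernel_plus :: "'h set" where "kernel_plus = {n \<in> D. T n = - n}"

lemma kernel_plus_D: "n \<in> kernel_plus \<Longrightarrow> n \<in> D" "n \<in> kernel_plus \<Longrightarrow> T n = - n"
  by (auto simp: kernel_plus_def)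

text \<open>
  The kernel of $1 + T = (1 - A_0)^*$ is the orthogonal complement of the range of $1 - A_0$.
\<close>
lemma kernel_plus_orthogonal:
  "n \<in> kernel_plus \<longleftrightarrow> (\<forall>z\<in>D0. inner (z - T z) n = 0)"
  using adjoint[of n "- n"] by (auto simp: kernel_plus_def inner_diff_left)

lemma subspace_kernel_plus: "subspace kernel_plus"
  by (auto simp: subspace_def kernel_plus_orthogonal inner_add_right)

lemma closed_kernel_plus: "closed kernel_plus"
proof -
  have "kernel_plus = (\<Inter>z\<in>D0. {n. inner (z - T z) n = 0})"
    using kernel_plus_orthogonal by auto
  then show ?thesis by (auto intro!: closed_INT closed_Collect_eq continuous_intros)
qed

lemma kernel_plus_norm:
  assumes "n \<in> kernel_plus"
  shows "2 * (norm n)\<^sup>2 = (norm (F2 n))\<^sup>2 - (norm (F1 n))\<^sup>2"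
  using inner_T_self[of n] kernel_plus_D[OF assms] by (simp add: power2_norm_eq_inner)

text \<open>
  The range of $1 - A_0$ is closed, because $\langle A_0 z, z\rangle = 0$ implies
  $\|z\| \le \|z - A_0 z\|$ and $A_0$ is closed; so it has an orthogonal projection, and
  \<open>kernel_plus\<close> is its complement.
\<close>
lemma kernel_plus_decomposition:
  obtains z n where "z \<in> D0" "n \<in> kernel_plus" "f = (z - T z) + n"
proof -
  let ?R = "(\<lambda>z. z - T z) ` D0"
  have D0: "z \<in> D" if "z \<in> D0" for z using that D0_subset by blast
  have norm_le: "norm z \<le> norm (z - T z)" if z: "z \<in> D0" for z
  proof -
    have "inner (T z) z = 0" using inner_T_self F_zero_on_D0 z D0 by fastforce
    then have "(norm (z - T z))\<^sup>2 = (norm z)\<^sup>2 + (norm (T z))\<^sup>2"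
      unfolding power2_norm_eq_inner
      by (simp add: inner_diff_left inner_diff_right inner_commute)
    then have "(norm z)\<^sup>2 \<le> (norm (z - T z))\<^sup>2" by simp
    then show ?thesis by (rule power2_le_imp_le) simp
  qed
  have "subspace ?R"
  proof (rule subspaceI)
    have "0 \<in> D0" by (rule subspace_0[OF subspace_D0])
    moreover from T_scale[OF D0[OF this], of 0] have "T 0 = 0" by simp
    ultimately show "0 \<in> ?R" by (intro image_eqI[of _ _ 0]) simp_all
  next
    fix x y assume "x \<in> ?R" "y \<in> ?R"
    then obtain z w where "z \<in> D0" "w \<in> D0" "x = z - T z" "y = w - T w" by blast
    then have "z + w \<in> D0" "x + y = (z + w) - T (z + w)"
      by (simp_all add: subspace_add[OF subspace_D0] T_add D0)
    then show "x + y \<in> ?R" by blast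
  next
    fix c x assume "x \<in> ?R"
    then obtain z where "z \<in> D0" "x = z - T z" by blast
    then have "c *\<^sub>R z \<in> D0" "c *\<^sub>R x = c *\<^sub>R z - T (c *\<^sub>R z)"
      by (simp_all add: subspace_scale[OF subspace_D0] T_scale D0 scaleR_diff_right)
    then show "c *\<^sub>R x \<in> ?R" by blast
  qed
  moreover have "complete ?R"
  proof (rule completeI)
    fix y assume y: "\<forall>k. y k \<in> ?R" "Cauchy y"
    have "\<exists>z. z \<in> D0 \<and> y k = z - T z" for k using y(1) by blast
    then obtain z where z: "\<And>k. z k \<in> D0" "\<And>k. y k = z k - T (z k)"
      by metis
    have "Cauchy z"
    proof (rule CauchyI)
      fix e :: real assume "0 < e"
      then obtain M where M: "\<And>m n. m \<ge> M \<Longrightarrow> n \<ge> M \<Longrightarrow> norm (y m - y n) < e"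
        using CauchyD[OF y(2)] by blast
      have "norm (z m - z n) \<le> norm (y m - y n)" for m n
      proof -
        have eq: "y m - y n = (z m - z n) - T (z m - z n)"
          using T_diff[of "z m" "z n"] z D0 by simp
        show ?thesis
          unfolding eq by (intro norm_le subspace_diff[OF subspace_D0] z)
      qed
      with M show "\<exists>M. \<forall>m\<ge>M. \<forall>n\<ge>M. norm (z m - z n) < e" by (meson le_less_trans)
    qed
    then obtain l where l: "z \<longlonglongrightarrow> l" using Cauchy_convergent_iff convergent_def by blast
    obtain m where m: "y \<longlonglongrightarrow> m" using y(2) Cauchy_convergent_iff convergent_def by blast
    have "(\<lambda>k. z k - y k) \<longlonglongrightarrow> l - m" by (intro tendsto_intros l m)
    then have Tz: "(\<lambda>k. T (z k)) \<longlonglongrightarrow> l - m" using z(2) by simp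
    have "l \<in> D0" using D0_limit[OF z(1) l Tz] .
    moreover have "T l = l - m" using T_limit[OF _ l Tz] z(1) D0 by blast
    ultimately have "m \<in> ?R" by (intro image_eqI[of _ _ l]) simp_all
    with m show "\<exists>l\<in>?R. y \<longlonglongrightarrow> l" by blast
  qed
  ultimately obtain s where s: "s \<in> ?R" "\<And>t. t \<in> ?R \<Longrightarrow> inner (f - s) t = 0"
    using orthogonal_projection_exists by blast
  have "inner (z - T z) (f - s) = 0" if "z \<in> D0" for z
    using s(2)[OF imageI[OF that]] by (simp add: inner_commute)
  then have "f - s \<in> kernel_plus" using kernel_plus_orthogonal by blast
  then show ?thesis using s(1) that by force
qed

text \<open>
  This symmetry yields for the kernel of $1 - T$ and \<open>F1\<close> whatever holds for the kernel of $1 + T$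
  and \<open>F2\<close>.
\<close>
lemma skew_extension_uminus: "skew_extension D0 D (\<lambda>u. - T u) F2 F1"
proof
  fix u w
  show "u \<in> D \<and> - T u = w \<longleftrightarrow> (\<forall>z\<in>D0. inner (- T z) u = - inner z w)"
    using adjoint[of u "- w"] by (auto simp: equation_minus_iff)
next
  fix z l m assume "\<And>k. z k \<in> D0" "z \<longlonglongrightarrow> l" "(\<lambda>k. - T (z k)) \<longlonglongrightarrow> m"
  then show "l \<in> D0" using D0_limit[of z l "- m"] tendsto_minus by fastforce
next
  fix a b show "\<exists>u\<in>D. F2 u = a \<and> F1 u = b" using F_onto by blast
next
  fix u v assume "u \<in> D" "v \<in> D"
  then show "inner (- T u) v + inner u (- T v) = inner (F2 u) (F2 v) - inner (F1 u) (F1 v)"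
    using green[of u v] by simp
qed (use subspace_D0 D0_subset F_add F_scale in auto)

definition kernel_minus :: "'h set" where "kernel_minus = {p \<in> D. T p = p}"

lemma kernel_minus_D: "p \<in> kernel_minus \<Longrightarrow> p \<in> D" "p \<in> kernel_minus \<Longrightarrow> T p = p"
  by (auto simp: kernel_minus_def)

lemma kernel_minus_eq: "kernel_minus = skew_extension.kernel_plus D (\<lambda>u. - T u)"
  unfolding kernel_minus_def skew_extension.kernel_plus_def[OF skew_extension_uminus] by simp

lemmas subspace_kernel_minus =
  skew_extension.subspace_kernel_plus[OF skew_extension_uminus, folded kernel_minus_eq]
lemmas closed_kernel_minus =
  skew_extension.closed_kernel_plus[OF skew_extension_uminus, folded kernel_minus_eq]

text \<open>
  On \<open>kernel_minus\<close> the operator $1 + T$ is multiplication by two, which takes care of the part of \<open>f\<close>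
  orthogonal to the range of $1 + A_0$.
\<close>
lemma one_plus_T_onto: "\<exists>u\<in>D. u + T u = f"
proof -
  obtain z p where zp: "z \<in> D0" "p \<in> kernel_minus" "f = z + T z + p"
    using skew_extension.kernel_plus_decomposition[OF skew_extension_uminus,
        folded kernel_minus_eq, of f]
    by auto
  have "z \<in> D" "(1/2) *\<^sub>R p \<in> D" "T ((1/2) *\<^sub>R p) = (1/2) *\<^sub>R p"
    using zp D0_subset kernel_minus_D[OF zp(2)] T_scale[of p "1/2"] by auto
  then have "z + (1/2) *\<^sub>R p \<in> D" "z + (1/2) *\<^sub>R p + T (z + (1/2) *\<^sub>R p) = f"
    using T_add[of z "(1/2) *\<^sub>R p"] zp(3) scaleR_half_double[of p]
    by (auto simp: scaleR_2 scaleR_add_right add_ac)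
  then show ?thesis by blast
qed

text \<open>
  If \<open>v\<close> has boundary value \<open>(0, y)\<close>, then $\langle F_2 n, y\rangle = \langle n, v - Tv\rangle$ for all
  \<open>n\<close> in \<open>kernel_plus\<close>.  Hence the image of the unit ball is weakly bounded, and therefore bounded.
  The lower bound on \<open>M\<close> makes $1 - 2/M^2$ nonnegative, the square of the contraction constant
  in the fixed point arguments below.
\<close>
lemma F2_bounded_on_kernel_plus:
  obtains M where "M \<ge> 2" "\<And>n. n \<in> kernel_plus \<Longrightarrow> norm (F2 n) \<le> M * norm n"
proof -
  let ?S = "F2 ` {n \<in> kernel_plus. norm n \<le> 1}"
  have "bounded ?S"
  proof (rule weakly_bounded_imp_bounded)
    fix y
    obtain v where v: "v \<in> D" "F1 v = 0" "F2 v = y" using F_onto by blast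
    have "\<bar>inner (F2 n) y\<bar> \<le> norm (v - T v)" if "n \<in> kernel_plus" "norm n \<le> 1" for n
    proof -
      have "inner (F2 n) y = inner n (v - T v)"
        using green[of n v] v kernel_plus_D[OF that(1)] by (simp add: inner_diff_right)
      also have "\<bar>\<dots>\<bar> \<le> norm n * norm (v - T v)" by (rule Cauchy_Schwarz_ineq2)
      also have "\<dots> \<le> norm (v - T v)" using that(2) by (simp add: mult_left_le_one_le)
      finally show ?thesis .
    qed
    then show "\<exists>C. \<forall>x\<in>?S. \<bar>inner x y\<bar> \<le> C" by blast
  qed
  then obtain C where C: "\<And>n. n \<in> kernel_plus \<Longrightarrow> norm n \<le> 1 \<Longrightarrow> norm (F2 n) \<le> C"
    unfolding bounded_iff by blast
  have "norm (F2 n) \<le> max C 2 * norm n" if n: "n \<in> kernel_plus" for n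
  proof (cases "n = 0")
    case True
    then show ?thesis using F_scale(2)[of n 0] kernel_plus_D[OF n] by simp
  next
    case False
    have "inverse (norm n) *\<^sub>R n \<in> kernel_plus"
      using subspace_kernel_plus n by (rule subspace_scale)
    then have "norm (F2 (inverse (norm n) *\<^sub>R n)) \<le> C" using False by (intro C) simp_all
    then have "norm (F2 n) \<le> C * norm n"
      using False kernel_plus_D[OF n] by (simp add: F_scale field_simps)
    also have "\<dots> \<le> max C 2 * norm n" by (intro mult_right_mono) simp_all
    finally show ?thesis .
  qed
  then show ?thesis using that[of "max C 2"] by simp
qed

lemma norm_le_norm_F2: "n \<in> kernel_plus \<Longrightarrow> norm n \<le> norm (F2 n)"
proof (rule power2_le_imp_le)
  assume "n \<in> kernel_plus"
  from kernel_plus_norm[OF this] show "(norm n)\<^sup>2 \<le> (norm (F2 n))\<^sup>2"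
    using zero_le_power2[of "norm n"] zero_le_power2[of "norm (F1 n)"] by linarith
qed simp

text \<open>
  The range is complete since \<open>F2\<close> is bounded above and below on \<open>kernel_plus\<close>.  To see that it is
  dense, take \<open>y\<close> orthogonal to it and \<open>v\<close> with boundary value \<open>(0, y)\<close>: then $Tv - v$ is orthogonal
  to \<open>kernel_plus\<close>, hence of the form $z - A_0 z$, and $v + z$ is a vector in the kernel of $1 - T$ with
  the same boundary value.  The form is nonnegative on boundary values from that kernel, but its value at
  \<open>(0, y)\<close> is $-\|y\|^2$.
\<close>
lemma F2_kernel_plus_onto: "F2 ` kernel_plus = UNIV"
proof -
  let ?R = "F2 ` kernel_plus"
  obtain M where M: "M \<ge> 2" "\<And>n. n \<in> kernel_plus \<Longrightarrow> norm (F2 n) \<le> M * norm n"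
    using F2_bounded_on_kernel_plus by blast
  have F2_diff: "F2 (m - n) = F2 m - F2 n" if "m \<in> kernel_plus" "n \<in> kernel_plus" for m n
    using that by (simp add: kernel_plus_D F_diff)
  note diff = subspace_diff[OF subspace_kernel_plus]
  have "subspace ?R"
  proof (rule subspaceI)
    have "0 \<in> kernel_plus" by (rule subspace_0[OF subspace_kernel_plus])
    moreover from F2_diff[OF this this] have "F2 0 = 0" by simp
    ultimately show "0 \<in> ?R" by (metis image_eqI)
  next
    fix x y assume "x \<in> ?R" "y \<in> ?R"
    then obtain m n where mn: "m \<in> kernel_plus" "n \<in> kernel_plus" "x = F2 m" "y = F2 n" by blast
    then have "m + n \<in> kernel_plus" by (intro subspace_add[OF subspace_kernel_plus])
    moreover have "x + y = F2 (m + n)" using mn F_add(2) kernel_plus_D(1) by simp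
    ultimately show "x + y \<in> ?R" by blast
  next
    fix c x assume "x \<in> ?R"
    then obtain n where n: "n \<in> kernel_plus" "x = F2 n" by blast
    then have "c *\<^sub>R n \<in> kernel_plus" by (intro subspace_scale[OF subspace_kernel_plus])
    moreover have "c *\<^sub>R x = F2 (c *\<^sub>R n)" using n F_scale(2) kernel_plus_D(1) by simp
    ultimately show "c *\<^sub>R x \<in> ?R" by blast
  qed
  moreover have "complete ?R"
  proof (rule completeI)
    fix y assume y: "\<forall>k. y k \<in> ?R" "Cauchy y"
    have "\<exists>n. n \<in> kernel_plus \<and> y k = F2 n" for k using y(1) by blast
    then obtain n where n: "\<And>k. n k \<in> kernel_plus" "\<And>k. y k = F2 (n k)"
      by metis
    have le: "norm (n j - n k) \<le> norm (y j - y k)" for j k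
      using norm_le_norm_F2[OF diff[OF n(1)[of j] n(1)[of k]]] n F2_diff by simp
    have "Cauchy n"
    proof (rule CauchyI)
      fix e :: real assume "0 < e"
      then obtain K where "\<And>j k. j \<ge> K \<Longrightarrow> k \<ge> K \<Longrightarrow> norm (y j - y k) < e"
        using CauchyD[OF y(2)] by blast
      then show "\<exists>K. \<forall>j\<ge>K. \<forall>k\<ge>K. norm (n j - n k) < e" by (meson le le_less_trans)
    qed
    then obtain l where l: "n \<longlonglongrightarrow> l" using Cauchy_convergent_iff convergent_def by blast
    have l_ker: "l \<in> kernel_plus"
      using closed_kernel_plus n(1) l closed_sequentially by blast
    have "(\<lambda>k. M * norm (n k - l)) \<longlonglongrightarrow> M * norm (l - l)" by (intro tendsto_intros l)
    then have null: "(\<lambda>k. M * norm (n k - l)) \<longlonglongrightarrow> 0" by simp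
    have "norm (y k - F2 l) \<le> M * norm (n k - l)" for k
      using M(2)[OF diff[OF n(1)[of k] l_ker]] n F2_diff l_ker by simp
    then have "(\<lambda>k. y k - F2 l) \<longlonglongrightarrow> 0"
      by (intro Lim_null_comparison[OF _ null] always_eventually allI)
    then have "y \<longlonglongrightarrow> F2 l" by (simp add: LIM_zero_iff)
    with l_ker show "\<exists>l\<in>?R. y \<longlonglongrightarrow> l" by blast
  qed
  ultimately have proj: "\<exists>s\<in>?R. \<forall>t\<in>?R. inner (b - s) t = 0" for b
    by (rule orthogonal_projection_exists[of ?R b]) blast+
  have dense: "y = 0" if y: "\<And>t. t \<in> ?R \<Longrightarrow> inner y t = 0" for y
  proof -
    obtain v where v: "v \<in> D" "F1 v = 0" "F2 v = y" using F_onto by blast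
    obtain z n where zn: "z \<in> D0" "n \<in> kernel_plus" "T v - v = (z - T z) + n"
      using kernel_plus_decomposition by blast
    have "inner (T v) n + inner v (T n) = 0"
      using green[of v n] v y zn(2) kernel_plus_D[OF zn(2)] by simp
    then have "inner (T v - v) n = 0"
      using kernel_plus_D[OF zn(2)] by (simp add: inner_diff_left)
    moreover have "inner (z - T z) n = 0" using zn kernel_plus_orthogonal by blast
    ultimately have "n = 0" using zn(3) by (simp add: inner_add_left)
    let ?u = "v + z"
    have z: "z \<in> D" using zn D0_subset by blast
    have "T ?u = ?u" using T_add[OF v(1) z] zn(3) \<open>n = 0\<close> by (simp add: algebra_simps)
    moreover have "F1 ?u = 0" "F2 ?u = y"
      using F_add[OF v(1) z] F_zero_on_D0[OF zn(1)] v by simp_all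
    moreover have "?u \<in> D" using T_add[OF v(1) z] by blast
    ultimately have "2 * (norm ?u)\<^sup>2 = - (norm y)\<^sup>2"
      using inner_T_self[of ?u] by (simp add: power2_norm_eq_inner)
    then have "(norm y)\<^sup>2 \<le> 0" using zero_le_power2[of "norm ?u"] by linarith
    then show "y = 0" by simp
  qed
  have "b \<in> ?R" for b
  proof -
    obtain s where "s \<in> ?R" "\<forall>t\<in>?R. inner (b - s) t = 0" using proj by blast
    moreover from this dense have "b - s = 0" by blast
    ultimately show ?thesis by simp
  qed
  then show ?thesis by blast
qed


section \<open>Passing between the two splittings\<close>

lemma contraction_constant:
  obtains M :: real where "M > 0" "0 \<le> 1 - 2 / M\<^sup>2" "sqrt (1 - 2 / M\<^sup>2) < 1"
    "\<And>n. n \<in> kernel_plus \<Longrightarrow> norm (F2 n) \<le> M * norm n"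
proof -
  obtain M where M: "M \<ge> 2" "\<And>n. n \<in> kernel_plus \<Longrightarrow> norm (F2 n) \<le> M * norm n"
    using F2_bounded_on_kernel_plus by blast
  have "2\<^sup>2 \<le> M\<^sup>2" using M(1) by (intro power_mono) auto
  then have "2 / M\<^sup>2 \<le> 1" using M(1) by (simp add: divide_le_eq)
  moreover have "2 / M\<^sup>2 > 0" using M(1) by simp
  ultimately show ?thesis using that[of M] M by simp
qed

text \<open>
  Let \<open>E\<close> invert \<open>F2\<close> on \<open>kernel_plus\<close>.  Then $y = F_2 n$ has to be a fixed point of
  $y \mapsto g(a + F_1 E y) - b$, and this map is a strict contraction: on \<open>kernel_plus\<close> one has
  $\|F_1 n\|^2 = \|F_2 n\|^2 - 2\|n\|^2 \le (1 - 2/M^2)\|F_2 n\|^2$.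
\<close>
lemma kernel_plus_meets_nonexpansive:
  assumes g: "\<And>x y. norm (g x - g y) \<le> norm (x - y)"
  shows "\<exists>n\<in>kernel_plus. g (a + F1 n) = b + F2 n"
proof -
  obtain M where M: "M > 0" "0 \<le> 1 - 2 / M\<^sup>2" "sqrt (1 - 2 / M\<^sup>2) < 1"
    "\<And>n. n \<in> kernel_plus \<Longrightarrow> norm (F2 n) \<le> M * norm n"
    using contraction_constant by blast
  define c where "c = sqrt (1 - 2 / M\<^sup>2)"
  have contract: "norm (F1 n) \<le> c * norm (F2 n)" if n: "n \<in> kernel_plus" for n
  proof (rule power2_le_imp_le)
    have "(norm (F2 n))\<^sup>2 \<le> (M * norm n)\<^sup>2" using M(4)[OF n] by (intro power_mono) auto
    then have "2 / M\<^sup>2 * (norm (F2 n))\<^sup>2 \<le> 2 * (norm n)\<^sup>2"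
      using M(1) by (simp add: field_simps)
    then show "(norm (F1 n))\<^sup>2 \<le> (c * norm (F2 n))\<^sup>2"
      using kernel_plus_norm[OF n] M(2) by (simp add: c_def power_mult_distrib algebra_simps)
    show "0 \<le> c * norm (F2 n)" using M(2) by (simp add: c_def)
  qed
  define E where "E = inv_into kernel_plus F2"
  have E: "E y \<in> kernel_plus" "F2 (E y) = y" for y
    unfolding E_def using F2_kernel_plus_onto by (auto intro: inv_into_into f_inv_into_f)
  have "dist (g (a + F1 (E x)) - b) (g (a + F1 (E y)) - b) \<le> c * dist x y" for x y
  proof -
    have "dist (g (a + F1 (E x)) - b) (g (a + F1 (E y)) - b) \<le> norm (F1 (E x) - F1 (E y))"
      using g[of "a + F1 (E x)" "a + F1 (E y)"] by (simp add: dist_norm)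
    also have "\<dots> = norm (F1 (E x - E y))" using F_diff kernel_plus_D E by metis
    also have "\<dots> \<le> c * norm (F2 (E x - E y))"
      by (intro contract subspace_diff[OF subspace_kernel_plus] E)
    also have "\<dots> = c * dist x y" using F_diff kernel_plus_D E by (metis dist_norm)
    finally show ?thesis .
  qed
  then obtain y where "g (a + F1 (E y)) - b = y"
    using banach_fix_type[of c "\<lambda>y. g (a + F1 (E y)) - b"] M by (auto simp: c_def)
  then have "g (a + F1 (E y)) = b + F2 (E y)" using E by (simp add: algebra_simps)
  with E show ?thesis by blast
qed

lemmas F1_kernel_minus_onto =
  skew_extension.F2_kernel_plus_onto[OF skew_extension_uminus, folded kernel_minus_eq]

text \<open>
  The converse passage, from a graph over \<open>kernel_minus\<close> to one over $G_1$.  With \<open>E\<close> the inverse of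
  \<open>F1\<close> on \<open>kernel_minus\<close>, the equation reads $p = E(a - F_1(h\,p))$.  The right-hand side is a
  strict contraction, because $\|q\| \le c\|n\|$ whenever \<open>q\<close> in \<open>kernel_minus\<close> and \<open>n\<close> in
  \<open>kernel_plus\<close> satisfy $F_1 q = F_1 n$: then $n - q$ has boundary value $(0, y)$, and Green's
  identity for the pairs $(n-q, n-q)$ and $(n-q, n)$ gives $2\|n\|^2 - 2\|q\|^2 = \|y\|^2$ and
  $2\|n\|^2 = \langle y, F_2 n\rangle \le M\|y\|\|n\|$.
\<close>
lemma F1_onto_graph:
  assumes h: "\<And>p. p \<in> kernel_minus \<Longrightarrow> h p \<in> kernel_plus"
    and nonexp: "\<And>p q. p \<in> kernel_minus \<Longrightarrow> q \<in> kernel_minus \<Longrightarrow> norm (h p - h q) \<le> norm (p - q)"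
  shows "\<exists>p\<in>kernel_minus. F1 (p + h p) = a"
proof -
  obtain M where M: "M > 0" "0 \<le> 1 - 2 / M\<^sup>2" "sqrt (1 - 2 / M\<^sup>2) < 1"
    "\<And>n. n \<in> kernel_plus \<Longrightarrow> norm (F2 n) \<le> M * norm n"
    using contraction_constant by blast
  define c where "c = sqrt (1 - 2 / M\<^sup>2)"
  have contract: "norm q \<le> c * norm n"
    if n: "n \<in> kernel_plus" and q: "q \<in> kernel_minus" and eq: "F1 q = F1 n" for n q
  proof (rule power2_le_imp_le)
    let ?y = "F2 (n - q)"
    have D: "n \<in> D" "q \<in> D" "n - q \<in> D" and T: "T (n - q) = - n - q"
      using kernel_plus_D[OF n] kernel_minus_D[OF q] T_diff by auto
    have F1: "F1 (n - q) = 0" using F_diff D eq by simp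
    have "2 * (norm n)\<^sup>2 = inner ?y (F2 n)"
      using green[OF D(3,1)] F1 T kernel_plus_D[OF n]
      by (simp add: power2_norm_eq_inner inner_diff_right inner_commute)
    also have "\<dots> \<le> norm ?y * (M * norm n)"
      using M(4)[OF n] norm_cauchy_schwarz[of ?y "F2 n"]
      by (meson mult_left_mono norm_ge_zero order_trans)
    finally have "2 * norm n \<le> M * norm ?y"
      by (cases "norm n = 0") (use M(1) in \<open>auto simp: power2_eq_square algebra_simps\<close>)
    then have "(2 * norm n)\<^sup>2 \<le> (M * norm ?y)\<^sup>2" by (intro power_mono) auto
    then have "4 / M\<^sup>2 * (norm n)\<^sup>2 \<le> (norm ?y)\<^sup>2"
      using M(1) by (simp add: field_simps)
    moreover have "2 * (norm q)\<^sup>2 = 2 * (norm n)\<^sup>2 - (norm ?y)\<^sup>2"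
      using inner_T_self[OF D(3)] F1 T
      by (simp add: power2_norm_eq_inner inner_diff_left inner_diff_right inner_commute)
    ultimately show "(norm q)\<^sup>2 \<le> (c * norm n)\<^sup>2"
      using M(2) by (simp add: c_def power_mult_distrib algebra_simps)
    show "0 \<le> c * norm n" using M(2) by (simp add: c_def)
  qed
  define E where "E = inv_into kernel_minus F1"
  have E: "E x \<in> kernel_minus" "F1 (E x) = x" for x
    unfolding E_def using F1_kernel_minus_onto by (auto intro: inv_into_into f_inv_into_f)
  let ?\<Phi> = "\<lambda>p. E (a - F1 (h p))"
  have "dist (?\<Phi> p) (?\<Phi> q) \<le> c * dist p q" if "p \<in> kernel_minus" "q \<in> kernel_minus" for p q
  proof -
    have D: "E x \<in> D" "h p \<in> D" "h q \<in> D" for x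
      using E h that kernel_plus_D kernel_minus_D by blast+
    have "norm (?\<Phi> q - ?\<Phi> p) \<le> c * norm (h p - h q)"
    proof (rule contract)
      show "h p - h q \<in> kernel_plus"
        by (intro subspace_diff[OF subspace_kernel_plus] h that)
      show "?\<Phi> q - ?\<Phi> p \<in> kernel_minus" by (intro subspace_diff[OF subspace_kernel_minus] E)
      show "F1 (?\<Phi> q - ?\<Phi> p) = F1 (h p - h q)" using F_diff(1) D E(2) by simp
    qed
    also have "\<dots> \<le> c * norm (p - q)"
      using nonexp[OF that] M(2) by (intro mult_left_mono) (auto simp: c_def)
    finally show ?thesis by (simp add: dist_norm norm_minus_commute)
  qed
  moreover have "complete kernel_minus" using closed_kernel_minus complete_eq_closed by blast
  moreover have "kernel_minus \<noteq> {}" using E(1) by blast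
  ultimately have "\<exists>!p\<in>kernel_minus. ?\<Phi> p = p"
    using M E(1) by (intro Banach_fix[where c = c]) (auto simp: c_def)
  then obtain p where p: "p \<in> kernel_minus" "?\<Phi> p = p" by blast
  then have "F1 p = a - F1 (h p)" using E(2) by metis
  then have "F1 (p + h p) = a"
    using F_add(1) p(1) h kernel_plus_D kernel_minus_D by simp
  with p(1) show ?thesis by blast
qed

section \<open>Accretive restrictions\<close>

lemma inner_T_diff:
  assumes "u \<in> D" "v \<in> D"
  shows "2 * inner (T u - T v) (u - v) = (norm (F1 u - F1 v))\<^sup>2 - (norm (F2 u - F2 v))\<^sup>2"
  using inner_T_self[of "u - v"] T_diff[OF assms] F_diff[OF assms] by simp

text \<open>
  Start from any solution in \<open>D\<close> of $u + Tu = f$; adding an element of the kernel of $1 + T$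
  yields another solution, which can be chosen to satisfy the boundary condition.
\<close>
lemma nonexpansive_imp_one_plus_T_onto:
  assumes g: "\<And>x y. norm (g x - g y) \<le> norm (x - y)"
  shows "(\<lambda>u. u + T u) ` {u \<in> D. g (F1 u) = F2 u} = UNIV"
proof -
  have ex: "\<exists>u\<in>D. g (F1 u) = F2 u \<and> u + T u = f" for f
  proof -
    obtain u where u: "u \<in> D" "u + T u = f" using one_plus_T_onto by blast
    obtain n where n: "n \<in> kernel_plus" "g (F1 u + F1 n) = F2 u + F2 n"
      using kernel_plus_meets_nonexpansive[of g] g by blast
    note nD = kernel_plus_D[OF n(1)]
    have "u + n \<in> D" "u + n + T (u + n) = f" "g (F1 (u + n)) = F2 (u + n)"
      using T_add[OF u(1) nD(1)] F_add[OF u(1) nD(1)] u(2) n(2) nD(2) by auto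
    then show ?thesis by blast
  qed
  have "f \<in> (\<lambda>u. u + T u) ` {u \<in> D. g (F1 u) = F2 u}" for f
    using ex[of f] by (auto intro: image_eqI[rotated])
  then show ?thesis by blast
qed

text \<open>
  For \<open>p\<close> in \<open>kernel_minus\<close>, the solution \<open>u\<close> in \<open>C\<close> of $u + Tu = 2p$ differs from the solution \<open>p\<close>
  by an element $h\,p$ of \<open>kernel_plus\<close>.  So \<open>C\<close> contains the graph of \<open>h\<close>, and accretivity means that
  \<open>h\<close> is nonexpansive, since $Tu = p - h\,p$.
\<close>
lemma accretive_onto_imp_F1_onto:
  assumes C: "C \<subseteq> D"
    and acc: "\<And>u v. u \<in> C \<Longrightarrow> v \<in> C \<Longrightarrow> inner (T u - T v) (u - v) \<ge> 0"
    and onto: "(\<lambda>u. u + T u) ` C = UNIV"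
  shows "F1 ` C = UNIV"
proof -
  have "\<exists>u. u \<in> C \<and> u + T u = f" for f
    using onto by (metis (no_types, lifting) UNIV_I imageE)
  then obtain R where R: "R f \<in> C" "R f + T (R f) = f" for f
    by metis
  define h where "h p = R (2 *\<^sub>R p) - p" for p
  have TR: "T (R (2 *\<^sub>R p)) = p - h p" for p
    using R(2)[of "2 *\<^sub>R p"] by (simp add: h_def scaleR_2 algebra_simps)
  have "h p \<in> kernel_plus" if p: "p \<in> kernel_minus" for p
    using T_diff[of "R (2 *\<^sub>R p)" p] TR[of p] kernel_minus_D[OF p] R(1) C
    by (auto simp: kernel_plus_def h_def)
  moreover have "norm (h p - h q) \<le> norm (p - q)" for p q
  proof -
    have "0 \<le> inner ((p - q) - (h p - h q)) ((p - q) + (h p - h q))"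
      using acc[OF R(1) R(1), of "2 *\<^sub>R p" "2 *\<^sub>R q"] TR
      by (simp add: h_def algebra_simps)
    also have "\<dots> = (norm (p - q))\<^sup>2 - (norm (h p - h q))\<^sup>2"
      unfolding power2_norm_eq_inner inner_diff_left[of "p - q"] inner_add_right
      by (simp add: inner_commute)
    finally have "(norm (h p - h q))\<^sup>2 \<le> (norm (p - q))\<^sup>2" by simp
    then show ?thesis by (rule power2_le_imp_le) simp
  qed
  ultimately have ex: "\<exists>p\<in>kernel_minus. F1 (p + h p) = a" for a
    by (rule F1_onto_graph)
  have "p + h p \<in> C" for p using R(1) by (simp add: h_def)
  then have "a \<in> F1 ` C" for a using ex[of a] by (metis image_eqI)
  then show ?thesis by blast
qed

lemma accretive_onto_iff_nonexpansive:
  assumes C: "C \<subseteq> D"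
  shows "(\<forall>u\<in>C. \<forall>v\<in>C. inner (T u - T v) (u - v) \<ge> 0) \<and> (\<lambda>u. u + T u) ` C = UNIV \<longleftrightarrow>
    (\<exists>g. (\<forall>a b. norm (g a - g b) \<le> norm (a - b)) \<and> C = {u \<in> D. g (F1 u) = F2 u})"
    (is "?acc \<and> ?onto \<longleftrightarrow> ?graph")
proof
  assume ?graph
  then obtain g where g: "\<And>a b. norm (g a - g b) \<le> norm (a - b)"
    and C_eq: "C = {u \<in> D. g (F1 u) = F2 u}" by blast
  have ?acc
  proof (intro ballI)
    fix u v assume "u \<in> C" "v \<in> C"
    then have uv: "u \<in> D" "v \<in> D" "g (F1 u) = F2 u" "g (F1 v) = F2 v"
      by (auto simp: C_eq)
    have "(norm (F2 u - F2 v))\<^sup>2 \<le> (norm (F1 u - F1 v))\<^sup>2"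
      using g[of "F1 u" "F1 v"] uv by (intro power_mono) auto
    then show "0 \<le> inner (T u - T v) (u - v)" using inner_T_diff[OF uv(1,2)] by linarith
  qed
  with nonexpansive_imp_one_plus_T_onto[of g] g C_eq show "?acc \<and> ?onto" by simp
next
  assume m_acc: "?acc \<and> ?onto"
  have le: "norm (F2 u - F2 v) \<le> norm (F1 u - F1 v)" if "u \<in> C" "v \<in> C" for u v
  proof (rule power2_le_imp_le)
    have "0 \<le> 2 * inner (T u - T v) (u - v)" using m_acc that by simp
    then show "(norm (F2 u - F2 v))\<^sup>2 \<le> (norm (F1 u - F1 v))\<^sup>2"
      using inner_T_diff[of u v] subsetD[OF C that(1)] subsetD[OF C that(2)] by linarith
  qed simp
  have "F1 ` C = UNIV" using m_acc C by (intro accretive_onto_imp_F1_onto) auto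
  then have "\<exists>u. u \<in> C \<and> F1 u = a" for a
    by (metis UNIV_I imageE)
  then obtain s where s: "s a \<in> C" "F1 (s a) = a" for a
    by metis
  define g where "g a = F2 (s a)" for a
  have "norm (g a - g b) \<le> norm (a - b)" for a b
    using le[OF s(1)[of a] s(1)[of b]] by (simp add: s g_def)
  moreover have g_eq: "g (F1 u) = F2 u" if "u \<in> C" for u
    using le[OF s(1) that, of "F1 u"] by (simp add: s g_def)
  (* Maximality: u has the boundary value of an element of C, so accretivity extends to
     pairs of u with elements of C; comparing it with the solution v in C of v + T v = u + T u forces u = v. *)
  moreover have "u \<in> C" if u: "u \<in> D" "g (F1 u) = F2 u" for u
  proof -
    obtain v where v: "v \<in> C" "v + T v = u + T u"
      using m_acc by (metis (no_types, lifting) UNIV_I imageE)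
    have nonneg: "2 * inner (T u - T v) (u - v) \<ge> 0"
    proof -
      have "norm (F2 u - F2 v) \<le> norm (F1 u - F1 v)"
        using le[OF s(1) v(1), of "F1 u"] u(2) by (simp add: s g_def)
      then have "(norm (F2 u - F2 v))\<^sup>2 \<le> (norm (F1 u - F1 v))\<^sup>2" by (intro power_mono) auto
      then show ?thesis using inner_T_diff[of u v] subsetD[OF C v(1)] u(1) by linarith
    qed
    have "T u - T v = - (u - v)" using v(2) by (simp add: algebra_simps)
    from nonneg[unfolded this inner_minus_left] have "inner (u - v) (u - v) \<le> 0" by linarith
    then have "u = v" by (metis inner_gt_zero_iff not_less right_minus_eq)
    with v(1) show ?thesis by simp
  qed
  ultimately have "(\<forall>a b. norm (g a - g b) \<le> norm (a - b)) \<and> C = {u \<in> D. g (F1 u) = F2 u}"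
    using C by blast
  then show ?graph by blast
qed

end

theorem theorem3p1:
  fixes A0 A B :: "'h::{real_inner,complete_space} \<rightharpoonup> 'h"
    and F :: "'h \<Rightarrow> 'g1::{real_inner,complete_space} \<times> 'g2::{real_inner,complete_space}"
  assumes "linear_operator A0"
    and "densely_defined A0"
    and "closed_operator A0"
    and "skew_symmetric A0"
    and "A = op_uminus (op_adjoint A0)"
    and "boundary_system A F"
    and "B \<subseteq>\<^sub>m A"
  shows "m_accretive B \<longleftrightarrow>
    (\<exists>g :: 'g1 \<Rightarrow> 'g2.
       (\<forall>a b. norm (g a - g b) \<le> norm (a - b)) \<and>
       dom B = {u \<in> dom A. g (fst (F u)) = snd (F u)})"
proof -
  have A0_le: "A0 \<subseteq>\<^sub>m A" using assms(4,5) by (simp add: skew_symmetric_def)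
  have A0_eq: "A z = A0 z" if "z \<in> dom A0" for z using A0_le that by (simp add: map_le_def)
  have A_iff: "A u = Some w \<longleftrightarrow> (\<forall>z\<in>dom A0. inner (the (A0 z)) u = - inner z w)" for u w
  proof -
    have "A u = Some w \<longleftrightarrow> op_adjoint A0 u = Some (- w)"
      unfolding assms(5) op_uminus_def by (cases "op_adjoint A0 u") (auto simp: minus_equation_iff)
    then show ?thesis by (simp add: op_adjoint_eq_Some_iff[OF assms(2)])
  qed
  interpret skew_extension "dom A0" "dom A" "\<lambda>u. the (A u)" "\<lambda>u. fst (F u)" "\<lambda>u. snd (F u)"
  proof
    show "subspace (dom A0)" using assms(1) by (simp add: linear_operator_def)
    show "dom A0 \<subseteq> dom A" using A0_le by (rule map_le_implies_dom_le)
  next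
    fix u w
    have "u \<in> dom A \<and> the (A u) = w \<longleftrightarrow> A u = Some w" by auto
    then show "u \<in> dom A \<and> the (A u) = w \<longleftrightarrow>
        (\<forall>z\<in>dom A0. inner (the (A z)) u = - inner z w)"
      by (simp add: A_iff A0_eq)
  next
    fix z l m
    assume z: "\<And>k. z k \<in> dom A0" "z \<longlonglongrightarrow> l" "(\<lambda>k. the (A (z k))) \<longlonglongrightarrow> m"
    have "(z k, the (A (z k))) \<in> Map.graph A0" for k
      using z(1)[of k] by (auto simp: Map.graph_def A0_eq)
    moreover have "(\<lambda>k. (z k, the (A (z k)))) \<longlonglongrightarrow> (l, m)" using z by (intro tendsto_Pair)
    ultimately have "(l, m) \<in> Map.graph A0"
      by (rule closed_sequentially[OF assms(3)[unfolded closed_operator_def]])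
    then show "l \<in> dom A0" by (auto simp: Map.graph_def)
  next
    fix a b
    have "(a, b) \<in> F ` dom A" using assms(6) by (simp add: boundary_system_def)
    then obtain u where "u \<in> dom A" "F u = (a, b)" by (metis imageE)
    then show "\<exists>u\<in>dom A. fst (F u) = a \<and> snd (F u) = b" by (metis fst_conv snd_conv)
  qed (use assms(6) in \<open>auto simp: boundary_system_def\<close>)
  have B: "dom B \<subseteq> dom A" "\<And>u. u \<in> dom B \<Longrightarrow> B u = A u"
    using map_le_implies_dom_le[OF assms(7)] assms(7) by (simp_all add: map_le_def)
  have "m_accretive B \<longleftrightarrow>
      (\<forall>u\<in>dom B. \<forall>v\<in>dom B. inner (the (A u) - the (A v)) (u - v) \<ge> 0) \<and>
      (\<lambda>u. u + the (A u)) ` dom B = UNIV"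
    unfolding m_accretive_def accretive_def using B(2) by (simp cong: image_cong)
  then show ?thesis using accretive_onto_iff_nonexpansive[OF B(1)] by simp
qed

end
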